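(* Let $\psi\colon G\twoheadrightarrow H$ be an epimorphism of groups and let $R$ be a $G$-graded ring. If $R$ is simple and $R^{\rm hom}=R_{[\psi]}^{\rm hom}$, then $R_{[\psi]}$ is simple. Conversely, if $\ker(\psi)$ is torsionfree and $R_{[\psi]}$ is simple, then $R$ is simple and $R^{\rm hom}=R_{[\psi]}^{\rm hom}$.
   Context: Groups are commutative and written additively; rings are commutative with $1$. A $G$-graded ring is a ring $R$ with a family $(R_g)_{g\in G}$ of additive subgroups whose direct sum is $R$ and with $R_gR_h\subseteq R_{g+h}$. $R^{\rm hom}:=\bigcup_{g\in G}R_g$ is the set of homogeneous elements. For an epimorphism of groups $\psi\colon G\twoheadrightarrow H$, the $\psi$-coarsening $R_{[\psi]}$ is the $H$-graded ring with the same underlying ring as $R$ and with component of degree $h\in H$ equal to $\bigoplus_{g\in\psi^{-1}(h)}R_g$. A graded ring $R$ is called simple if $R\neq 0$ and every nonzero homogeneous element of $R$ is invertible. *)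

theory Defs
  imports "HOL-Algebra.Algebra"
begin

definition external_sum :: "('r, 'm) ring_scheme \<Rightarrow> 'i set \<Rightarrow> ('i \<Rightarrow> 'r set) \<Rightarrow> ('i \<Rightarrow> 'r) monoid"
  where "external_sum R I A = sum_group I (\<lambda>i. (add_monoid R)\<lparr>carrier := A i\<rparr>)"

text \<open>Unlike \<^const>\<open>finsum\<close>, \<^const>\<open>gfinprod\<close> allows an infinite index set as long as the
  support of the family is finite.\<close>

definition summation :: "('r, 'm) ring_scheme \<Rightarrow> 'i set \<Rightarrow> ('i \<Rightarrow> 'r) \<Rightarrow> 'r"
  where "summation R I f = gfinprod (add_monoid R) f I"

text \<open>In the following locale, the ring being the direct sum of the family means that the
  canonical map from the external direct sum is bijective. The degree groups are written
  multiplicatively, as is usual in HOL-Algebra.\<close>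

locale graded_ring = G: comm_group G + R: cring R
  for G :: "('g, 'k) monoid_scheme" (structure) and R :: "('r, 'm) ring_scheme" (structure) +
  fixes A :: "'g \<Rightarrow> 'r set"
  assumes component_subgroup: "\<And>g. g \<in> carrier G \<Longrightarrow> additive_subgroup (A g) R"
    and component_mult: "\<And>g h a b. \<lbrakk>g \<in> carrier G; h \<in> carrier G; a \<in> A g; b \<in> A h\<rbrakk>
      \<Longrightarrow> a \<otimes>\<^bsub>R\<^esub> b \<in> A (g \<otimes>\<^bsub>G\<^esub> h)"
    and direct_sum: "bij_betw (summation R (carrier G)) (carrier (external_sum R (carrier G) A)) (carrier R)"

definition homogeneous :: "('g, 'k) monoid_scheme \<Rightarrow> ('g \<Rightarrow> 'r set) \<Rightarrow> 'r set"
  where "homogeneous G A = (\<Union>g\<in>carrier G. A g)"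

definition coarsening :: "('g, 'k) monoid_scheme \<Rightarrow> ('r, 'm) ring_scheme \<Rightarrow> ('g \<Rightarrow> 'h)
    \<Rightarrow> ('g \<Rightarrow> 'r set) \<Rightarrow> 'h \<Rightarrow> 'r set"
  where "coarsening G R \<psi> A h =
    (let I = {g \<in> carrier G. \<psi> g = h} in summation R I ` carrier (external_sum R I A))"

definition graded_simple :: "('g, 'k) monoid_scheme \<Rightarrow> ('r, 'm) ring_scheme \<Rightarrow> ('g \<Rightarrow> 'r set) \<Rightarrow> bool"
  where "graded_simple G R A \<longleftrightarrow> carrier R \<noteq> {\<zero>\<^bsub>R\<^esub>} \<and>
    (\<forall>x \<in> homogeneous G A. x \<noteq> \<zero>\<^bsub>R\<^esub> \<longrightarrow> x \<in> Units R)"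

definition torsionfree :: "('g, 'k) monoid_scheme \<Rightarrow> bool"
  where "torsionfree K \<longleftrightarrow>
    (\<forall>x \<in> carrier K. \<forall>n::nat. 0 < n \<longrightarrow> x [^]\<^bsub>K\<^esub> n = \<one>\<^bsub>K\<^esub> \<longrightarrow> x = \<one>\<^bsub>K\<^esub>)"

context graded_ring
begin

lemma component_group:
  assumes "g \<in> carrier G" shows "group ((add_monoid R)\<lparr>carrier := A g\<rparr>)"
  using component_subgroup[OF assms] R.add.is_group
  unfolding additive_subgroup_def by (rule subgroup.subgroup_is_group)

lemma carrier_external_sum:
  assumes "I \<subseteq> carrier G"
  shows "carrier (external_sum R I A) = {f \<in> \<Pi>\<^sub>E i\<in>I. A i. finite {i \<in> I. f i \<noteq> \<zero>\<^bsub>R\<^esub>}}"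
  unfolding external_sum_def
  by (subst carrier_sum_group) (use assms component_group in auto)

lemma component_in_carrier: "g \<in> carrier G \<Longrightarrow> a \<in> A g \<Longrightarrow> a \<in> carrier R"
  using component_subgroup additive_subgroup.a_subset by blast

lemma zero_in_component: "g \<in> carrier G \<Longrightarrow> \<zero>\<^bsub>R\<^esub> \<in> A g"
  using component_subgroup additive_subgroup.zero_closed by blast

lemma summation_eq_finsum:
  assumes "finite {i \<in> I. f i \<noteq> \<zero>\<^bsub>R\<^esub>}"
  shows "summation R I f = finsum R f {i \<in> I. f i \<noteq> \<zero>\<^bsub>R\<^esub>}"
  using assms by (simp add: summation_def gfinprod_def finsum_def)

lemma summation_hom:
  assumes "I \<subseteq> carrier G"
  shows "summation R I \<in> hom (external_sum R I A) (add_monoid R)"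
proof -
  have "(\<lambda>x. x) \<in> hom ((add_monoid R)\<lparr>carrier := A i\<rparr>) (add_monoid R)" if "i \<in> I" for i
    using that assms component_in_carrier by (auto simp: hom_def)
  moreover have "group ((add_monoid R)\<lparr>carrier := A i\<rparr>)" if "i \<in> I" for i
    using that assms component_group by blast
  ultimately have "(\<lambda>f. gfinprod (add_monoid R) (\<lambda>i. f i) I) \<in>
      hom (sum_group I (\<lambda>i. (add_monoid R)\<lparr>carrier := A i\<rparr>)) (add_monoid R)"
    by (rule comm_group.hom_group_sum[OF R.a_comm_group, where f = "\<lambda>i x. x"])
  moreover have "summation R I = (\<lambda>f. gfinprod (add_monoid R) (\<lambda>i. f i) I)"
    by (simp add: summation_def fun_eq_iff)
  ultimately show ?thesis by (simp only: external_sum_def)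
qed

lemma coarsening_subgroup: "additive_subgroup (coarsening G R \<psi> A h) R"
proof -
  let ?I = "{g \<in> carrier G. \<psi> g = h}"
  have I: "?I \<subseteq> carrier G" by auto
  have "group (external_sum R ?I A)"
    unfolding external_sum_def by (rule sum_group) (use component_group in auto)
  then have "group_hom (external_sum R ?I A) (add_monoid R) (summation R ?I)"
    using summation_hom[OF I] R.add.is_group by (simp add: group_hom_def group_hom_axioms_def)
  from group_hom.img_is_subgroup[OF this] show ?thesis
    by (simp add: additive_subgroup_def coarsening_def Let_def)
qed

lemma finsum_in_subgroup:
  assumes "additive_subgroup B R" "\<And>i. i \<in> J \<Longrightarrow> f i \<in> B"
  shows "finsum R f J \<in> B"
  using assms(2)
proof (induction J rule: infinite_finite_induct)
  case (insert x F)
  then have "f x \<in> carrier R" "f \<in> F \<rightarrow> carrier R"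
    using additive_subgroup.a_subset[OF assms(1)] by blast+
  then show ?case
    using insert by (simp add: R.finsum_insert additive_subgroup.a_closed[OF assms(1)])
qed (use additive_subgroup.zero_closed[OF assms(1)] in auto)

lemma coarseningE:
  assumes "x \<in> coarsening G R \<psi> A h"
  obtains f J where "finite J" "J \<subseteq> {g \<in> carrier G. \<psi> g = h}" "\<And>g. g \<in> J \<Longrightarrow> f g \<in> A g"
    "x = finsum R f J"
proof -
  let ?I = "{g \<in> carrier G. \<psi> g = h}"
  obtain f where f: "f \<in> carrier (external_sum R ?I A)" "x = summation R ?I f"
    using assms by (auto simp: coarsening_def Let_def)
  then have "f \<in> (\<Pi>\<^sub>E i\<in>?I. A i)" "finite {i \<in> ?I. f i \<noteq> \<zero>\<^bsub>R\<^esub>}"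
    using carrier_external_sum[of ?I] by auto
  with f summation_eq_finsum[of ?I f] show thesis
    by (intro that[of "{i \<in> ?I. f i \<noteq> \<zero>\<^bsub>R\<^esub>}" f]) auto
qed

lemma component_subset_coarsening:
  assumes g: "g \<in> carrier G" shows "A g \<subseteq> coarsening G R \<psi> A (\<psi> g)"
proof
  fix a assume a: "a \<in> A g"
  let ?I = "{g' \<in> carrier G. \<psi> g' = \<psi> g}"
  define f where "f = (\<lambda>i\<in>?I. if i = g then a else \<zero>\<^bsub>R\<^esub>)"
  have sub: "{i \<in> ?I. f i \<noteq> \<zero>\<^bsub>R\<^esub>} \<subseteq> {g}" by (auto simp: f_def)
  then have fin: "finite {i \<in> ?I. f i \<noteq> \<zero>\<^bsub>R\<^esub>}" using finite_subset by blast
  have f: "f \<in> carrier (external_sum R ?I A)"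
    using a fin zero_in_component by (subst carrier_external_sum) (auto simp: f_def)
  have ac: "a \<in> carrier R" using a g component_in_carrier by blast
  have "summation R ?I f = finsum R f {g}"
    unfolding summation_eq_finsum[OF fin]
    by (rule R.add.finprod_mono_neutral_cong_left) (use sub ac g in \<open>auto simp: f_def\<close>)
  also have "\<dots> = a" using ac g by (simp add: f_def R.finsum_insert[of "{}", simplified])
  finally show "a \<in> coarsening G R \<psi> A (\<psi> g)"
    using f by (auto simp: coarsening_def Let_def)
qed

lemma coarsening_mult:
  assumes \<psi>: "\<psi> \<in> hom G H"
    and x: "x \<in> coarsening G R \<psi> A h" and y: "y \<in> coarsening G R \<psi> A h'"
  shows "x \<otimes>\<^bsub>R\<^esub> y \<in> coarsening G R \<psi> A (h \<otimes>\<^bsub>H\<^esub> h')"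
proof -
  obtain f J where f: "finite J" "J \<subseteq> {g \<in> carrier G. \<psi> g = h}"
    "\<And>g. g \<in> J \<Longrightarrow> f g \<in> A g" "x = finsum R f J"
    using coarseningE[OF x] by blast
  obtain f' J' where f': "finite J'" "J' \<subseteq> {g \<in> carrier G. \<psi> g = h'}"
    "\<And>g. g \<in> J' \<Longrightarrow> f' g \<in> A g" "y = finsum R f' J'"
    using coarseningE[OF y] by blast
  have fc: "f \<in> J \<rightarrow> carrier R" "f' \<in> J' \<rightarrow> carrier R"
    using f f' component_in_carrier by blast+
  then have yc: "y \<in> carrier R" using f' by simp
  have "x \<otimes>\<^bsub>R\<^esub> y = (\<Oplus>\<^bsub>R\<^esub>g\<in>J. f g \<otimes>\<^bsub>R\<^esub> y)"
    using R.finsum_ldistr[OF f(1) yc fc(1)] f(4) by simp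
  also have "\<dots> \<in> coarsening G R \<psi> A (h \<otimes>\<^bsub>H\<^esub> h')"
  proof (rule finsum_in_subgroup[OF coarsening_subgroup])
    fix g assume g: "g \<in> J"
    then have "f g \<otimes>\<^bsub>R\<^esub> y = (\<Oplus>\<^bsub>R\<^esub>g'\<in>J'. f g \<otimes>\<^bsub>R\<^esub> f' g')"
      using R.finsum_rdistr[OF f'(1) _ fc(2)] fc(1) f'(4) by blast
    also have "\<dots> \<in> coarsening G R \<psi> A (h \<otimes>\<^bsub>H\<^esub> h')"
    proof (rule finsum_in_subgroup[OF coarsening_subgroup])
      fix g' assume g': "g' \<in> J'"
      have gg: "g \<in> carrier G" "g' \<in> carrier G" "\<psi> g = h" "\<psi> g' = h'"
        using g g' f(2) f'(2) by auto
      then have "\<psi> (g \<otimes>\<^bsub>G\<^esub> g') = h \<otimes>\<^bsub>H\<^esub> h'" using hom_mult[OF \<psi>] by auto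
      moreover have "f g \<otimes>\<^bsub>R\<^esub> f' g' \<in> A (g \<otimes>\<^bsub>G\<^esub> g')"
        using component_mult gg f(3)[OF g] f'(3)[OF g'] by blast
      ultimately show "f g \<otimes>\<^bsub>R\<^esub> f' g' \<in> coarsening G R \<psi> A (h \<otimes>\<^bsub>H\<^esub> h')"
        using component_subset_coarsening[of "g \<otimes>\<^bsub>G\<^esub> g'" \<psi>] gg by auto
    qed
    finally show "f g \<otimes>\<^bsub>R\<^esub> y \<in> coarsening G R \<psi> A (h \<otimes>\<^bsub>H\<^esub> h')" .
  qed
  finally show ?thesis .
qed

lemma carrier_external_sum_coarsening:
  "carrier (external_sum R I (coarsening G R \<psi> A))
    = {f \<in> \<Pi>\<^sub>E i\<in>I. coarsening G R \<psi> A i. finite {i \<in> I. f i \<noteq> \<zero>\<^bsub>R\<^esub>}}"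
proof -
  have "group ((add_monoid R)\<lparr>carrier := coarsening G R \<psi> A h\<rparr>)" for h
    using coarsening_subgroup[of \<psi> h] R.add.is_group
    unfolding additive_subgroup_def by (rule subgroup.subgroup_is_group)
  then show ?thesis
    unfolding external_sum_def by (subst carrier_sum_group) auto
qed

lemma coarsening_group_terms:
  assumes \<psi>: "\<psi> \<in> hom G H" and f: "f \<in> carrier (external_sum R (carrier G) A)"
  defines "F \<equiv> (\<lambda>h\<in>carrier H. summation R {g \<in> carrier G. \<psi> g = h} f)"
  shows "F \<in> carrier (external_sum R (carrier H) (coarsening G R \<psi> A))"
    and "summation R (carrier H) F = summation R (carrier G) f"
proof -
  let ?I = "\<lambda>h. {g \<in> carrier G. \<psi> g = h}"
  let ?S = "{g \<in> carrier G. f g \<noteq> \<zero>\<^bsub>R\<^esub>}"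
  let ?T = "\<lambda>h. {g \<in> ?I h. f g \<noteq> \<zero>\<^bsub>R\<^esub>}"
  have fA: "f g \<in> A g" if "g \<in> carrier G" for g
    using f that unfolding carrier_external_sum[OF subset_refl] by blast
  then have fc: "f g \<in> carrier R" if "g \<in> carrier G" for g
    using that component_in_carrier by blast
  have finS: "finite ?S" using f unfolding carrier_external_sum[OF subset_refl] by blast
  have finT: "finite (?T h)" for h by (rule finite_subset[OF _ finS]) auto
  have Fh: "F h = finsum R f (?T h)" if "h \<in> carrier H" for h
    using that summation_eq_finsum[OF finT] by (simp add: F_def)
  have "F h \<in> coarsening G R \<psi> A h" if h: "h \<in> carrier H" for h
    unfolding Fh[OF h]
    by (rule finsum_in_subgroup[OF coarsening_subgroup])
      (use fA component_subset_coarsening in blast)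
  moreover have supp: "{h \<in> carrier H. F h \<noteq> \<zero>\<^bsub>R\<^esub>} \<subseteq> \<psi> ` ?S"
  proof
    fix h assume h: "h \<in> {h \<in> carrier H. F h \<noteq> \<zero>\<^bsub>R\<^esub>}"
    have "?T h \<noteq> {}"
    proof
      assume T: "?T h = {}"
      have "h \<in> carrier H" using h by simp
      from Fh[OF this] have "F h = finsum R f {}" unfolding T .
      then show False using h by simp
    qed
    then show "h \<in> \<psi> ` ?S" by blast
  qed
  moreover have finF: "finite {h \<in> carrier H. F h \<noteq> \<zero>\<^bsub>R\<^esub>}"
    using supp finS finite_subset by blast
  ultimately show "F \<in> carrier (external_sum R (carrier H) (coarsening G R \<psi> A))"
    unfolding carrier_external_sum_coarsening by (auto simp: F_def)
  have psiS: "\<psi> ` ?S \<subseteq> carrier H" using \<psi> by (auto simp: hom_def)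
  have Fc: "finsum R f (?T h) \<in> carrier R" for h
    by (rule R.finsum_closed) (use fc in auto)
  have "summation R (carrier G) f = finsum R f (\<Union>(?T ` (\<psi> ` ?S)))"
    unfolding summation_eq_finsum[OF finS] by (rule arg_cong[where f = "finsum R f"]) auto
  also have "\<dots> = finsum R (\<lambda>h. finsum R f (?T h)) (\<psi> ` ?S)"
    by (rule R.add.finprod_UN_disjoint)
      (use finS finT fc in \<open>auto simp: pairwise_def disjnt_def\<close>)
  also have "\<dots> = finsum R F {h \<in> carrier H. F h \<noteq> \<zero>\<^bsub>R\<^esub>}"
    by (rule R.add.finprod_mono_neutral_cong_right[OF finite_imageI[OF finS] supp])
      (use psiS Fh Fc in auto)
  finally show "summation R (carrier H) F = summation R (carrier G) f"
    using summation_eq_finsum[OF finF] by simp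
qed

lemma coarsening_family_arises:
  assumes \<psi>: "\<psi> \<in> hom G H"
    and F: "F \<in> carrier (external_sum R (carrier H) (coarsening G R \<psi> A))"
  obtains f where "f \<in> carrier (external_sum R (carrier G) A)"
    "F = (\<lambda>h\<in>carrier H. summation R {g \<in> carrier G. \<psi> g = h} f)"
proof -
  let ?I = "\<lambda>h. {g \<in> carrier G. \<psi> g = h}"
  have psi: "\<psi> g \<in> carrier H" if "g \<in> carrier G" for g using \<psi> that by (auto simp: hom_def)
  have FP: "F \<in> (\<Pi>\<^sub>E h\<in>carrier H. coarsening G R \<psi> A h)"
    and finF: "finite {h \<in> carrier H. F h \<noteq> \<zero>\<^bsub>R\<^esub>}"
    using F unfolding carrier_external_sum_coarsening by auto
  have sumcar: "carrier (external_sum R (?I h) A)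
      = {f \<in> \<Pi>\<^sub>E i\<in>?I h. A i. finite {i \<in> ?I h. f i \<noteq> \<zero>\<^bsub>R\<^esub>}}" for h
    by (rule carrier_external_sum) auto
  have "\<exists>f. f \<in> carrier (external_sum R (?I h) A) \<and> F h = summation R (?I h) f \<and>
      (F h = \<zero>\<^bsub>R\<^esub> \<longrightarrow> (\<forall>g\<in>?I h. f g = \<zero>\<^bsub>R\<^esub>))" if h: "h \<in> carrier H" for h
  proof (cases "F h = \<zero>\<^bsub>R\<^esub>")
    case True
    have "(\<lambda>g\<in>?I h. \<zero>\<^bsub>R\<^esub>) \<in> carrier (external_sum R (?I h) A)"
      using zero_in_component by (auto simp: sumcar cong: conj_cong)
    moreover have "summation R (?I h) (\<lambda>g\<in>?I h. \<zero>\<^bsub>R\<^esub>) = \<zero>\<^bsub>R\<^esub>"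
    proof -
      have "{g \<in> ?I h. (\<lambda>g\<in>?I h. \<zero>\<^bsub>R\<^esub>) g \<noteq> \<zero>\<^bsub>R\<^esub>} = {}" by auto
      then show ?thesis
        using summation_eq_finsum[of "?I h" "\<lambda>g\<in>?I h. \<zero>\<^bsub>R\<^esub>"]
        by (simp only: R.finsum_empty finite.emptyI)
    qed
    ultimately show ?thesis using True by (intro exI[of _ "\<lambda>g\<in>?I h. \<zero>\<^bsub>R\<^esub>"]) auto
  next
    case False
    have "F h \<in> coarsening G R \<psi> A h" using FP h by auto
    then show ?thesis using False by (auto simp: coarsening_def Let_def)
  qed
  then have "\<forall>h\<in>carrier H. \<exists>f. f \<in> carrier (external_sum R (?I h) A) \<and> F h = summation R (?I h) f \<and>
      (F h = \<zero>\<^bsub>R\<^esub> \<longrightarrow> (\<forall>g\<in>?I h. f g = \<zero>\<^bsub>R\<^esub>))" by (rule ballI)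
  from bchoice[OF this] obtain k where k: "\<And>h. h \<in> carrier H \<Longrightarrow> k h \<in> carrier (external_sum R (?I h) A)"
    "\<And>h. h \<in> carrier H \<Longrightarrow> F h = summation R (?I h) (k h)"
    "\<And>h g. \<lbrakk>h \<in> carrier H; F h = \<zero>\<^bsub>R\<^esub>; g \<in> ?I h\<rbrakk> \<Longrightarrow> k h g = \<zero>\<^bsub>R\<^esub>"
    by blast
  define f where "f = (\<lambda>g\<in>carrier G. k (\<psi> g) g)"
  have kA: "k (\<psi> g) g \<in> A g" if "g \<in> carrier G" for g
    using k(1)[OF psi[OF that]] that by (auto simp: sumcar)
  have "{g \<in> carrier G. f g \<noteq> \<zero>\<^bsub>R\<^esub>}
      \<subseteq> (\<Union>h\<in>{h \<in> carrier H. F h \<noteq> \<zero>\<^bsub>R\<^esub>}. {g \<in> ?I h. k h g \<noteq> \<zero>\<^bsub>R\<^esub>})"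
    using k(3) psi by (fastforce simp: f_def)
  moreover have "finite \<dots>" using finF k(1) by (auto simp: sumcar)
  ultimately have "finite {g \<in> carrier G. f g \<noteq> \<zero>\<^bsub>R\<^esub>}" using finite_subset by blast
  then have f: "f \<in> carrier (external_sum R (carrier G) A)"
    using kA by (subst carrier_external_sum) (auto simp: f_def)
  have "F h = summation R (?I h) f" if h: "h \<in> carrier H" for h
  proof -
    have kc: "k h \<in> ?I h \<rightarrow> carrier R"
      using k(1)[OF h] component_in_carrier by (auto simp: sumcar)
    have "summation R (?I h) (k h) = summation R (?I h) f"
      unfolding summation_def
    proof (rule comm_monoid.gfinprod_cong[OF R.a_comm_monoid])
      show "k h \<in> ?I h \<rightarrow> carrier (add_monoid R)" using kc by simp
      show "g \<in> ?I h =simp=> k h g = f g" for g by (auto simp: f_def simp_implies_def)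
    qed simp
    then show ?thesis using k(2)[OF h] by simp
  qed
  then have "F = (\<lambda>h\<in>carrier H. summation R (?I h) f)"
    using FP by (auto simp: fun_eq_iff PiE_def extensional_def)
  with f that show thesis by blast
qed

theorem coarsening_graded_ring:
  assumes H: "comm_group H" and \<psi>: "\<psi> \<in> hom G H"
  shows "graded_ring H R (coarsening G R \<psi> A)"
proof -
  interpret H: comm_group H by (rule H)
  let ?E = "carrier (external_sum R (carrier G) A)"
  let ?E' = "carrier (external_sum R (carrier H) (coarsening G R \<psi> A))"
  let ?group = "\<lambda>f. \<lambda>h\<in>carrier H. summation R {g \<in> carrier G. \<psi> g = h} f"
  note group_mem = coarsening_group_terms(1)[OF \<psi>] and group_sum = coarsening_group_terms(2)[OF \<psi>]
  have inj: "inj_on (summation R (carrier G)) ?E" and img: "summation R (carrier G) ` ?E = carrier R"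
    using direct_sum by (auto simp: bij_betw_def)
  have "inj_on (summation R (carrier H)) ?E'"
  proof (rule inj_onI)
    fix F F' assume F: "F \<in> ?E'" "F' \<in> ?E'" "summation R (carrier H) F = summation R (carrier H) F'"
    obtain f where f: "f \<in> ?E" "F = ?group f" using coarsening_family_arises[OF \<psi> F(1)] by blast
    obtain f' where f': "f' \<in> ?E" "F' = ?group f'" using coarsening_family_arises[OF \<psi> F(2)] by blast
    have "summation R (carrier G) f = summation R (carrier G) f'"
      using F(3) unfolding f(2) f'(2) group_sum[OF f(1)] group_sum[OF f'(1)] .
    then have "f = f'" using inj f(1) f'(1) by (simp add: inj_on_def)
    then show "F = F'" using f f' by simp
  qed
  moreover have "summation R (carrier H) ` ?E' = carrier R"
  proof
    show "summation R (carrier H) ` ?E' \<subseteq> carrier R"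
    proof safe
      fix F assume F: "F \<in> ?E'"
      obtain f where f: "f \<in> ?E" "F = ?group f" using coarsening_family_arises[OF \<psi> F] by blast
      then have "summation R (carrier H) F = summation R (carrier G) f"
        using group_sum[OF f(1)] by (simp only:)
      then show "summation R (carrier H) F \<in> carrier R" using img f(1) by blast
    qed
    show "carrier R \<subseteq> summation R (carrier H) ` ?E'"
    proof
      fix x assume "x \<in> carrier R"
      then obtain f where f: "f \<in> ?E" "x = summation R (carrier G) f" using img by blast
      then show "x \<in> summation R (carrier H) ` ?E'"
        using imageI[OF group_mem[OF f(1)], of "summation R (carrier H)"]
        unfolding group_sum[OF f(1)] by (simp only:)
    qed
  qed
  ultimately have "bij_betw (summation R (carrier H)) ?E' (carrier R)"
    by (simp add: bij_betw_def)
  then show ?thesis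
    by (intro graded_ring.intro graded_ring_axioms.intro)
      (use coarsening_subgroup coarsening_mult[OF \<psi>] H R.cring_axioms in auto)
qed

end

end

theory Submission
  imports Defs
begin

text \<open>The first half is immediate, since being simple depends on the grading only through its set
  of homogeneous elements.

  For the converse, let \<open>K\<close> be the kernel of \<open>\<psi>\<close>. Every homogeneous element of \<open>R\<close> is
  homogeneous for the coarsening, so \<open>R\<close> is simple, and the point is that a nonzero \<open>x\<close> in a
  component of the coarsening has only one nonzero component in the original grading. Such an
  \<open>x\<close> has an inverse \<open>y\<close>, and its degrees lie in a single coset of \<open>K\<close>. A torsionfree abelian
  group can be totally ordered (\<open>torsionfree_total_cone\<close>), and the order on \<open>K\<close> gives a partial
  order on \<open>G\<close> whose restriction to each coset of \<open>K\<close> is total. Let \<open>s\<close> be the largest degree of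
  \<open>x\<close> and \<open>t\<close> a maximal degree of \<open>y\<close>. Then \<open>s \<otimes> t\<close> arises from no other pair of degrees
  (\<open>extremal_pair\<close>), so the component of \<open>x y\<close> there is \<open>x\<^sub>s y\<^sub>t\<close>, which is nonzero
  because \<open>x\<^sub>s\<close> is a unit. As \<open>x y\<close> is the identity, whose degree is trivial, \<open>t\<close> is the inverse
  of \<open>s\<close>. In the same way, if \<open>u\<close> is the smallest degree of \<open>x\<close>, its inverse is a degree of \<open>y\<close>.
  But \<open>u \<le> s\<close> makes the inverse of \<open>u\<close> at least \<open>t\<close>, and maximality of \<open>t\<close> forces \<open>u = s\<close>
  (\<open>unit_homogeneous\<close>).\<close>

section \<open>Ordering torsionfree abelian groups\<close>

text \<open>Such a \<open>P\<close> is the set of nonnegative elements for a translation invariant partial order on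
  \<open>G\<close>, in which \<open>a \<le> b\<close> means \<open>b \<otimes> inv a \<in> P\<close>. The order stays partial so that a cone
  of a subgroup is also a cone of \<open>G\<close>.\<close>

definition positive_cone :: "('g, 'k) monoid_scheme \<Rightarrow> 'g set \<Rightarrow> bool"
  where "positive_cone G P \<longleftrightarrow> P \<subseteq> carrier G \<and> \<one>\<^bsub>G\<^esub> \<in> P \<and>
    (\<forall>x\<in>P. \<forall>y\<in>P. x \<otimes>\<^bsub>G\<^esub> y \<in> P) \<and> (\<forall>x\<in>P. inv\<^bsub>G\<^esub> x \<in> P \<longrightarrow> x = \<one>\<^bsub>G\<^esub>)"

context comm_group
begin

lemma positive_cone_pow:
  assumes "positive_cone G P" "x \<in> P"
  shows "x [^] (n::nat) \<in> P"
  using assms by (induction n) (auto simp: positive_cone_def)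

lemma positive_cone_inverse:
  assumes "positive_cone G P"
  shows "positive_cone G {x \<in> carrier G. inv x \<in> P}"
  using assms unfolding positive_cone_def by (auto simp: inv_mult)

text \<open>The submonoid generated by \<open>P\<close> and \<open>a\<close> can only fail to be pointed through a relation
  \<open>p \<otimes> q \<otimes> a [^] k = \<one>\<close>, which for \<open>k > 0\<close> puts the inverse of a power of \<open>a\<close> into \<open>P\<close>.\<close>

lemma positive_cone_extend:
  assumes P: "positive_cone G P" and a: "a \<in> carrier G"
    and na: "\<And>n::nat. 0 < n \<Longrightarrow> inv (a [^] n) \<notin> P"
  shows "\<exists>Q. positive_cone G Q \<and> P \<subseteq> Q \<and> a \<in> Q"
proof (intro exI conjI)
  let ?Q = "{p \<otimes> a [^] (n::nat) | p n. p \<in> P}"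
  have PG: "p \<in> carrier G" if "p \<in> P" for p using P that by (auto simp: positive_cone_def)
  have one: "\<one> \<in> P" using P by (simp add: positive_cone_def)
  have mult: "p \<otimes> q \<in> P" if "p \<in> P" "q \<in> P" for p q using P that by (auto simp: positive_cone_def)
  have pointed: "p = \<one>" if "p \<in> P" "inv p \<in> P" for p using P that by (auto simp: positive_cone_def)
  show PQ: "P \<subseteq> ?Q"
  proof
    fix p assume "p \<in> P"
    then show "p \<in> ?Q" using PG by (intro CollectI exI[of _ p] exI[of _ "0::nat"]) auto
  qed
  show "a \<in> ?Q" using one a by (intro CollectI exI[of _ "\<one>"] exI[of _ "1::nat"]) auto
  show "positive_cone G ?Q"
    unfolding positive_cone_def
  proof (intro conjI ballI impI)
    show "?Q \<subseteq> carrier G" using PG a by auto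
    show "\<one> \<in> ?Q" using PQ one by blast
  next
    fix x y assume "x \<in> ?Q" "y \<in> ?Q"
    then obtain p n q m where x: "x = p \<otimes> a [^] (n::nat)" "p \<in> P" and y: "y = q \<otimes> a [^] (m::nat)" "q \<in> P"
      by blast
    have "x \<otimes> y = (p \<otimes> q) \<otimes> a [^] (n + m)"
      using x y a PG by (simp add: nat_pow_mult[symmetric] m_ac)
    then show "x \<otimes> y \<in> ?Q" using mult x y by blast
  next
    fix x assume "x \<in> ?Q" "inv x \<in> ?Q"
    then obtain p n q m where x: "x = p \<otimes> a [^] (n::nat)" "p \<in> P"
      and y: "inv x = q \<otimes> a [^] (m::nat)" "q \<in> P"
      by blast
    have c: "p \<in> carrier G" "q \<in> carrier G" "a [^] n \<in> carrier G" "a [^] m \<in> carrier G" using x y PG a by auto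
    have "\<one> = x \<otimes> inv x" using x c by simp
    also have "\<dots> = (p \<otimes> q) \<otimes> a [^] (n + m)"
      unfolding y(1) unfolding x(1) using c a by (simp add: nat_pow_mult[symmetric] m_ac)
    finally have e: "(p \<otimes> q) \<otimes> a [^] (n + m) = \<one>" by simp
    then have "inv (a [^] (n + m)) = p \<otimes> q" using c a by (intro inv_equality) auto
    then have "inv (a [^] (n + m)) \<in> P" using mult x y by simp
    then have "n + m = 0" using na by blast
    then have nm: "n = 0" "m = 0" by simp_all
    then have "p \<otimes> q = \<one>" using e c by simp
    then have "inv p = q" using c by (metis inv_equality m_comm)
    then have "p = \<one>" using pointed x(2) y(2) by blast
    then show "x = \<one>" using x(1) nm by simp
  qed
qed

text \<open>Levi's theorem that torsionfree abelian groups are orderable. A maximal cone is total: if neither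
  \<open>x\<close> nor its inverse could be added to it, then negative powers of \<open>x\<close> and of its inverse
  would already lie in it, hence also some \<open>x [^] k\<close> with \<open>k > 0\<close> together with its inverse.
  Pointedness and torsionfreeness then make \<open>x\<close> trivial.\<close>

theorem torsionfree_total_cone:
  assumes tf: "torsionfree G"
  obtains P where "positive_cone G P" "\<And>x. x \<in> carrier G \<Longrightarrow> x \<in> P \<or> inv x \<in> P"
proof -
  have ne: "Collect (positive_cone G) \<noteq> {}"
    by (auto simp: positive_cone_def intro!: exI[of _ "{\<one>}"])
  have "\<exists>P\<in>Collect (positive_cone G). \<forall>Q\<in>Collect (positive_cone G). P \<subseteq> Q \<longrightarrow> Q = P"
  proof (rule subset_Zorn_nonempty[OF ne])
    fix C assume C: "C \<noteq> {}" "subset.chain (Collect (positive_cone G)) C"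
    have cone: "positive_cone G P" if "P \<in> C" for P using C that by (auto simp: subset.chain_def)
    have common: "\<exists>Q\<in>C. x \<in> Q \<and> y \<in> Q" if xy: "x \<in> \<Union>C" "y \<in> \<Union>C" for x y
    proof -
      obtain Q Q' where "Q \<in> C" "Q' \<in> C" "x \<in> Q" "y \<in> Q'" using xy by blast
      moreover then have "Q \<subseteq> Q' \<or> Q' \<subseteq> Q" using C(2) unfolding subset_chain_def by blast
      ultimately show ?thesis by blast
    qed
    show "\<Union>C \<in> Collect (positive_cone G)"
      unfolding mem_Collect_eq positive_cone_def
    proof (intro conjI ballI impI)
      show "\<Union>C \<subseteq> carrier G" using cone unfolding positive_cone_def by blast
      show "\<one> \<in> \<Union>C" using cone C(1) unfolding positive_cone_def by blast
    next
      fix x y assume "x \<in> \<Union>C" "y \<in> \<Union>C"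
      with common[OF this] show "x \<otimes> y \<in> \<Union>C" using cone by (meson UnionI positive_cone_def)
    next
      fix x assume "x \<in> \<Union>C" "inv x \<in> \<Union>C"
      with common[OF this] show "x = \<one>" using cone by (meson positive_cone_def)
    qed
  qed
  then obtain P where P: "positive_cone G P" and max: "\<And>Q. positive_cone G Q \<Longrightarrow> P \<subseteq> Q \<Longrightarrow> Q = P"
    by blast
  have step: "\<exists>n::nat. 0 < n \<and> inv (a [^] n) \<in> P" if "a \<in> carrier G" "a \<notin> P" for a
    using positive_cone_extend[OF P that(1)] max that(2) by blast
  have "x \<in> P \<or> inv x \<in> P" if x: "x \<in> carrier G" for x
  proof (rule ccontr)
    assume c: "\<not> (x \<in> P \<or> inv x \<in> P)"
    obtain n :: nat where n: "0 < n" "inv (x [^] n) \<in> P" using step[OF x] c by blast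
    obtain m :: nat where m: "0 < m" "inv (inv x [^] m) \<in> P" using step[of "inv x"] c x by blast
    then have xm: "x [^] m \<in> P" using x by (simp add: nat_pow_inv)
    have "(x [^] m) [^] n \<in> P" by (rule positive_cone_pow[OF P xm])
    then have 1: "x [^] (m * n) \<in> P" using x by (simp add: nat_pow_pow)
    have "inv (x [^] n) [^] m \<in> P" by (rule positive_cone_pow[OF P n(2)])
    then have 2: "inv (x [^] (m * n)) \<in> P" using x by (simp add: nat_pow_pow nat_pow_inv mult.commute)
    have "x [^] (m * n) = \<one>" using P 1 2 by (auto simp: positive_cone_def)
    then have "x = \<one>" using tf x n(1) m(1) unfolding torsionfree_def by (metis nat_0_less_mult_iff)
    then show False using c P by (simp add: positive_cone_def)
  qed
  then show thesis using that P by blast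
qed

text \<open>For \<open>s\<close> the greatest element of \<open>S\<close>, an equation \<open>s' \<otimes> t' = s \<otimes> t\<close> gives \<open>t' \<ge> t\<close>.
  Hence \<open>t\<close> being merely maximal in \<open>T\<close> suffices for a unique product, and \<open>T\<close> is allowed to
  spread over incomparable cosets.\<close>

lemma extremal_pair:
  assumes P: "positive_cone G P"
    and S: "finite S" "S \<noteq> {}" "S \<subseteq> carrier G"
    and total: "\<And>s s'. s \<in> S \<Longrightarrow> s' \<in> S \<Longrightarrow> s \<otimes> inv s' \<in> P \<or> s' \<otimes> inv s \<in> P"
    and T: "finite T" "T \<noteq> {}" "T \<subseteq> carrier G"
  obtains s t where "s \<in> S" "t \<in> T"
    "\<And>s'. s' \<in> S \<Longrightarrow> s \<otimes> inv s' \<in> P" "\<And>t'. t' \<in> T \<Longrightarrow> t' \<otimes> inv t \<in> P \<Longrightarrow> t' = t"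
    "\<And>s' t'. s' \<in> S \<Longrightarrow> t' \<in> T \<Longrightarrow> s' \<otimes> t' = s \<otimes> t \<Longrightarrow> s' = s"
proof -
  define less where "less a b \<longleftrightarrow> a \<noteq> b \<and> b \<otimes> inv a \<in> P" for a b
  have one: "\<one> \<in> P" using P by (simp add: positive_cone_def)
  have mult: "p \<otimes> q \<in> P" if "p \<in> P" "q \<in> P" for p q using P that by (auto simp: positive_cone_def)
  have trans: "c \<otimes> inv a \<in> P" if "a \<in> carrier G" "b \<in> carrier G" "c \<in> carrier G"
    "b \<otimes> inv a \<in> P" "c \<otimes> inv b \<in> P" for a b c
  proof -
    have "c \<otimes> inv a = (c \<otimes> inv b) \<otimes> (b \<otimes> inv a)"
      using that by (simp add: m_assoc inv_solve_left)
    then show ?thesis using mult that by simp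
  qed
  have antisym: "a = b" if "a \<in> carrier G" "b \<in> carrier G" "b \<otimes> inv a \<in> P" "a \<otimes> inv b \<in> P" for a b
  proof -
    have "inv (b \<otimes> inv a) = a \<otimes> inv b" using that by (simp add: inv_mult_group)
    then have "b \<otimes> inv a = \<one>" using P that by (auto simp: positive_cone_def)
    then show ?thesis using that by (metis inv_equality inv_inv inv_closed)
  qed
  have maximal: "\<exists>m\<in>U. \<forall>x\<in>U. x \<otimes> inv m \<in> P \<longrightarrow> x = m" if U: "finite U" "U \<noteq> {}" "U \<subseteq> carrier G" for U
  proof -
    have "asymp_on U less" using antisym U(3) by (auto simp: less_def asymp_on_def)
    moreover have "transp_on U less"
      unfolding transp_on_def less_def using trans antisym U(3) by (metis subsetD)
    ultimately have "\<exists>m\<in>U. \<forall>x\<in>U. x \<noteq> m \<longrightarrow> \<not> less m x"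
      using Finite_Set.bex_max_element[OF U(1) _ _ U(2), of less] by blast
    then show ?thesis by (auto simp: less_def)
  qed
  obtain s where s: "s \<in> S" "\<And>s'. s' \<in> S \<Longrightarrow> s' \<otimes> inv s \<in> P \<Longrightarrow> s' = s" using maximal[OF S] by blast
  obtain t where t: "t \<in> T" "\<And>t'. t' \<in> T \<Longrightarrow> t' \<otimes> inv t \<in> P \<Longrightarrow> t' = t" using maximal[OF T] by blast
  have top: "s \<otimes> inv s' \<in> P" if "s' \<in> S" for s'
    using total[OF s(1) that] s(2)[OF that] one S(3) s(1) by auto
  moreover have "s' = s" if "s' \<in> S" "t' \<in> T" "s' \<otimes> t' = s \<otimes> t" for s' t'
  proof -
    have c: "s \<in> carrier G" "s' \<in> carrier G" "t \<in> carrier G" "t' \<in> carrier G" using that s t S(3) T(3) by auto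
    have "t' = inv s' \<otimes> (s \<otimes> t)" using c that(3) by (metis inv_solve_left m_closed)
    then have "t' = (s \<otimes> inv s') \<otimes> t" using c by (simp add: m_ac)
    then have "t' \<otimes> inv t = s \<otimes> inv s'" using c by (simp add: m_assoc)
    then have "t' = t" using t(2)[OF that(2)] top[OF that(1)] by simp
    then show ?thesis using that(3) c by simp
  qed
  ultimately show thesis using that[OF s(1) t(1)] t(2) by blast
qed

end

section \<open>Homogeneous components\<close>

context graded_ring
begin

definition component_of :: "'r \<Rightarrow> 'g \<Rightarrow> 'r"
  where "component_of x = inv_into (carrier (external_sum R (carrier G) A)) (summation R (carrier G)) x"

definition support :: "'r \<Rightarrow> 'g set"
  where "support x = {g \<in> carrier G. component_of x g \<noteq> \<zero>\<^bsub>R\<^esub>}"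

lemma component_of_family:
  assumes "x \<in> carrier R"
  shows "component_of x \<in> carrier (external_sum R (carrier G) A)" "summation R (carrier G) (component_of x) = x"
proof -
  have "x \<in> summation R (carrier G) ` carrier (external_sum R (carrier G) A)"
    using assms direct_sum by (simp add: bij_betw_def)
  from inv_into_into[OF this] f_inv_into_f[OF this]
  show "component_of x \<in> carrier (external_sum R (carrier G) A)"
    "summation R (carrier G) (component_of x) = x"
    by (simp_all only: component_of_def)
qed

lemma component_of_mem: "x \<in> carrier R \<Longrightarrow> g \<in> carrier G \<Longrightarrow> component_of x g \<in> A g"
  using component_of_family(1) unfolding carrier_external_sum[OF subset_refl] by blast

lemma component_of_closed: "x \<in> carrier R \<Longrightarrow> g \<in> carrier G \<Longrightarrow> component_of x g \<in> carrier R"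
  using component_of_mem component_in_carrier by blast

lemma finite_support: "x \<in> carrier R \<Longrightarrow> finite (support x)"
  using component_of_family(1) unfolding carrier_external_sum[OF subset_refl] support_def by blast

lemma sum_component_of: "x \<in> carrier R \<Longrightarrow> finsum R (component_of x) (support x) = x"
  using component_of_family(2) summation_eq_finsum[of "carrier G" "component_of x"] finite_support
  unfolding support_def by simp

lemma component_of_unique:
  assumes J: "finite J" "J \<subseteq> carrier G" and f: "\<And>g. g \<in> J \<Longrightarrow> f g \<in> A g" and g: "g \<in> carrier G"
  shows "component_of (finsum R f J) g = (if g \<in> J then f g else \<zero>\<^bsub>R\<^esub>)"
proof -
  let ?f = "\<lambda>g\<in>carrier G. if g \<in> J then f g else \<zero>\<^bsub>R\<^esub>"
  have sub: "{g \<in> carrier G. ?f g \<noteq> \<zero>\<^bsub>R\<^esub>} \<subseteq> J" by auto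
  then have fin: "finite {g \<in> carrier G. ?f g \<noteq> \<zero>\<^bsub>R\<^esub>}" using J(1) finite_subset by blast
  have fE: "?f \<in> carrier (external_sum R (carrier G) A)"
    unfolding carrier_external_sum[OF subset_refl] using fin f zero_in_component by auto
  have fc: "f \<in> J \<rightarrow> carrier R" using f J(2) component_in_carrier by blast
  have "summation R (carrier G) ?f = finsum R f J"
    unfolding summation_eq_finsum[OF fin]
    by (rule R.add.finprod_mono_neutral_cong_left[OF J(1) sub]) (use J(2) fc in auto)
  then have "component_of (finsum R f J) = ?f"
    using inv_into_f_f[OF bij_betw_imp_inj_on[OF direct_sum] fE] by (simp only: component_of_def)
  then show ?thesis using g by simp
qed

lemma component_of_homogeneous:
  assumes "g \<in> carrier G" "a \<in> A g" "h \<in> carrier G"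
  shows "component_of a h = (if h = g then a else \<zero>\<^bsub>R\<^esub>)"
proof -
  have "finsum R (\<lambda>_. a) {g} = a" using assms component_in_carrier by simp
  then show ?thesis using component_of_unique[of "{g}" "\<lambda>_. a" h] assms by auto
qed

text \<open>Multiplication by a homogeneous element only translates degrees, because the translated family
  again sums to the product and components are unique.\<close>

lemma component_of_mult_homogeneous:
  assumes g: "g \<in> carrier G" "a \<in> A g" and x: "x \<in> carrier R" and h: "h \<in> carrier G"
  shows "component_of (a \<otimes>\<^bsub>R\<^esub> x) h = a \<otimes>\<^bsub>R\<^esub> component_of x (inv g \<otimes> h)"
proof -
  let ?f = "\<lambda>k. a \<otimes>\<^bsub>R\<^esub> component_of x (inv g \<otimes> k)"
  let ?J = "(\<lambda>k. g \<otimes> k) ` support x"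
  have ac: "a \<in> carrier R" using g component_in_carrier by blast
  have sup: "support x \<subseteq> carrier G" by (auto simp: support_def)
  have canc: "inv g \<otimes> (g \<otimes> k) = k" "g \<otimes> (inv g \<otimes> k) = k" if "k \<in> carrier G" for k
    using that g(1) by (simp_all add: G.m_assoc[symmetric])
  have J: "finite ?J" "?J \<subseteq> carrier G" using finite_support[OF x] sup g(1) by auto
  have inj: "inj_on (\<lambda>k. g \<otimes> k) (support x)"
    using sup g(1) by (intro inj_onI) (metis G.l_cancel subsetD)
  have fc: "?f \<in> ?J \<rightarrow> carrier R" using sup g(1) ac x component_of_closed by auto
  have "finsum R ?f ?J = finsum R (\<lambda>k. ?f (g \<otimes> k)) (support x)"
    by (rule R.add.finprod_reindex[OF fc inj])
  also have "\<dots> = finsum R (\<lambda>k. a \<otimes>\<^bsub>R\<^esub> component_of x k) (support x)"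
    by (rule R.add.finprod_cong') (use sup canc ac x component_of_closed in auto)
  also have "\<dots> = a \<otimes>\<^bsub>R\<^esub> finsum R (component_of x) (support x)"
    by (rule R.finsum_rdistr[symmetric]) (use finite_support x ac sup component_of_closed in auto)
  also have "\<dots> = a \<otimes>\<^bsub>R\<^esub> x" using sum_component_of x by simp
  finally have eq: "finsum R ?f ?J = a \<otimes>\<^bsub>R\<^esub> x" .
  have "?f k \<in> A k" if "k \<in> ?J" for k
  proof -
    have k: "k \<in> carrier G" using that sup g(1) by auto
    have "?f k \<in> A (g \<otimes> (inv g \<otimes> k))"
      by (rule component_mult) (use k g x component_of_mem in auto)
    then show ?thesis using canc k by simp
  qed
  then have "component_of (a \<otimes>\<^bsub>R\<^esub> x) h = (if h \<in> ?J then ?f h else \<zero>\<^bsub>R\<^esub>)"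
    using component_of_unique[OF J, of ?f h] eq h by simp
  moreover have "?f h = \<zero>\<^bsub>R\<^esub>" if "h \<notin> ?J"
  proof -
    have "inv g \<otimes> h \<notin> support x" using that canc(2)[OF h] by (metis imageI)
    then show ?thesis using g(1) h ac by (simp add: support_def)
  qed
  ultimately show ?thesis by simp
qed

lemma component_of_add:
  assumes "x \<in> carrier R" "y \<in> carrier R" and g: "g \<in> carrier G"
  shows "component_of (x \<oplus>\<^bsub>R\<^esub> y) g = component_of x g \<oplus>\<^bsub>R\<^esub> component_of y g"
proof -
  let ?J = "support x \<union> support y"
  have J: "finite ?J" "?J \<subseteq> carrier G" using assms finite_support by (auto simp: support_def)
  have c: "component_of x \<in> ?J \<rightarrow> carrier R" "component_of y \<in> ?J \<rightarrow> carrier R" using J assms component_of_closed by blast+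
  have "finsum R (component_of x) ?J = x"
  proof -
    have "finsum R (component_of x) (support x) = finsum R (component_of x) ?J"
      by (rule R.add.finprod_mono_neutral_cong_left) (use J c in \<open>auto simp: support_def\<close>)
    then show ?thesis using sum_component_of assms by simp
  qed
  moreover have "finsum R (component_of y) ?J = y"
  proof -
    have "finsum R (component_of y) (support y) = finsum R (component_of y) ?J"
      by (rule R.add.finprod_mono_neutral_cong_left) (use J c in \<open>auto simp: support_def\<close>)
    then show ?thesis using sum_component_of assms by simp
  qed
  ultimately have "finsum R (\<lambda>k. component_of x k \<oplus>\<^bsub>R\<^esub> component_of y k) ?J = x \<oplus>\<^bsub>R\<^esub> y"
    using R.finsum_addf[OF c] by simp
  moreover have "component_of x k \<oplus>\<^bsub>R\<^esub> component_of y k \<in> A k" if "k \<in> carrier G" for k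
    using additive_subgroup.a_closed[OF component_subgroup[OF that]] component_of_mem assms that by blast
  then have "\<And>k. k \<in> ?J \<Longrightarrow> component_of x k \<oplus>\<^bsub>R\<^esub> component_of y k \<in> A k" using J(2) by blast
  ultimately have "component_of (x \<oplus>\<^bsub>R\<^esub> y) g = (if g \<in> ?J then component_of x g \<oplus>\<^bsub>R\<^esub> component_of y g else \<zero>\<^bsub>R\<^esub>)"
    using component_of_unique[OF J, of "\<lambda>k. component_of x k \<oplus>\<^bsub>R\<^esub> component_of y k" g] g by simp
  then show ?thesis using g by (auto simp: support_def)
qed

lemma component_of_finsum:
  assumes "finite I" "f \<in> I \<rightarrow> carrier R" "g \<in> carrier G"
  shows "component_of (finsum R f I) g = finsum R (\<lambda>i. component_of (f i) g) I"
  using assms(1,2)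
proof induction
  case empty
  show ?case using component_of_unique[of "{}" "\<lambda>_. \<zero>\<^bsub>R\<^esub>" g] assms(3) by simp
next
  case (insert i I)
  then have "(\<lambda>i. component_of (f i) g) \<in> I \<rightarrow> carrier R" "component_of (f i) g \<in> carrier R"
    using assms(3) component_of_closed by auto
  then show ?case using insert assms(3) by (simp add: component_of_add)
qed

lemma component_of_mult:
  assumes x: "x \<in> carrier R" and y: "y \<in> carrier R" and g: "g \<in> carrier G"
  shows "component_of (x \<otimes>\<^bsub>R\<^esub> y) g = finsum R (\<lambda>s. component_of x s \<otimes>\<^bsub>R\<^esub> component_of y (inv s \<otimes> g)) (support x)"
proof -
  have sup: "support x \<subseteq> carrier G" by (auto simp: support_def)
  have xc: "component_of x \<in> support x \<rightarrow> carrier R" using sup x component_of_closed by auto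
  have "x \<otimes>\<^bsub>R\<^esub> y = finsum R (\<lambda>s. component_of x s \<otimes>\<^bsub>R\<^esub> y) (support x)"
    using R.finsum_ldistr[OF finite_support[OF x] y xc] sum_component_of[OF x] by simp
  then have "component_of (x \<otimes>\<^bsub>R\<^esub> y) g = finsum R (\<lambda>s. component_of (component_of x s \<otimes>\<^bsub>R\<^esub> y) g) (support x)"
    using component_of_finsum[OF finite_support[OF x], of "\<lambda>s. component_of x s \<otimes>\<^bsub>R\<^esub> y" g] xc y g by auto
  also have "\<dots> = finsum R (\<lambda>s. component_of x s \<otimes>\<^bsub>R\<^esub> component_of y (inv s \<otimes> g)) (support x)"
    by (rule R.add.finprod_cong')
      (use sup x y g component_of_mem component_of_closed component_of_mult_homogeneous in auto)
  finally show ?thesis .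
qed

lemma component_of_mult_unique_product:
  assumes x: "x \<in> carrier R" and y: "y \<in> carrier R" and s: "s \<in> support x" and t: "t \<in> support y"
    and uniq: "\<And>s' t'. s' \<in> support x \<Longrightarrow> t' \<in> support y \<Longrightarrow> s' \<otimes> t' = s \<otimes> t \<Longrightarrow> s' = s"
  shows "component_of (x \<otimes>\<^bsub>R\<^esub> y) (s \<otimes> t) = component_of x s \<otimes>\<^bsub>R\<^esub> component_of y t"
proof -
  let ?F = "\<lambda>s'. component_of x s' \<otimes>\<^bsub>R\<^esub> component_of y (inv s' \<otimes> (s \<otimes> t))"
  have sup: "support x \<subseteq> carrier G" by (auto simp: support_def)
  have st: "s \<in> carrier G" "t \<in> carrier G" using s t by (auto simp: support_def)
  have F0: "?F s' = \<zero>\<^bsub>R\<^esub>" if s': "s' \<in> support x" "s' \<noteq> s" for s'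
  proof -
    have c: "s' \<in> carrier G" using s' sup by blast
    have "s' \<otimes> (inv s' \<otimes> (s \<otimes> t)) = s \<otimes> t" using c st by (simp add: G.m_assoc[symmetric])
    then have "inv s' \<otimes> (s \<otimes> t) \<notin> support y" using uniq s' by blast
    then have "component_of y (inv s' \<otimes> (s \<otimes> t)) = \<zero>\<^bsub>R\<^esub>" using c st by (simp add: support_def)
    then show ?thesis using component_of_closed x c by simp
  qed
  have Fs: "?F s = component_of x s \<otimes>\<^bsub>R\<^esub> component_of y t" using st by (simp add: G.m_assoc[symmetric])
  have Fc: "?F s' \<in> carrier R" if "s' \<in> support x" for s'
    using that sup st x y component_of_closed by (auto dest: subsetD)
  have "component_of (x \<otimes>\<^bsub>R\<^esub> y) (s \<otimes> t) = finsum R ?F (support x)" using component_of_mult x y st by simp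
  also have "\<dots> = finsum R ?F {s}"
    by (rule R.add.finprod_mono_neutral_cong_right) (use finite_support x s F0 Fc in auto)
  also have "\<dots> = component_of x s \<otimes>\<^bsub>R\<^esub> component_of y t" using Fs Fc[OF s] by simp
  finally show ?thesis .
qed

text \<open>The trivial component \<open>e\<close> of the identity fixes every homogeneous element \<open>a\<close>, by comparing
  components of \<open>a = a \<otimes>\<^bsub>R\<^esub> \<one>\<^bsub>R\<^esub>\<close> in the degree of \<open>a\<close>. Applied to the
  components of the identity, this gives \<open>e = \<one>\<^bsub>R\<^esub>\<close>.\<close>

lemma one_homogeneous: "\<one>\<^bsub>R\<^esub> \<in> A \<one>"
proof -
  let ?e = "component_of \<one>\<^bsub>R\<^esub> \<one>"
  have e: "?e \<in> carrier R" using component_of_closed by simp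
  have hom: "a \<otimes>\<^bsub>R\<^esub> ?e = a" if "g \<in> carrier G" "a \<in> A g" for g a
    using component_of_mult_homogeneous[OF that, of "\<one>\<^bsub>R\<^esub>" g] component_of_homogeneous[OF that that(1)]
      component_in_carrier[OF that] that(1) by simp
  let ?S = "support \<one>\<^bsub>R\<^esub>"
  have sup: "?S \<subseteq> carrier G" by (auto simp: support_def)
  have c: "component_of \<one>\<^bsub>R\<^esub> \<in> ?S \<rightarrow> carrier R" using sup component_of_closed by auto
  have "?e = finsum R (component_of \<one>\<^bsub>R\<^esub>) ?S \<otimes>\<^bsub>R\<^esub> ?e" using sum_component_of e by simp
  also have "\<dots> = finsum R (\<lambda>g. component_of \<one>\<^bsub>R\<^esub> g \<otimes>\<^bsub>R\<^esub> ?e) ?S"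
    by (rule R.finsum_ldistr) (use finite_support e c in auto)
  also have "\<dots> = finsum R (component_of \<one>\<^bsub>R\<^esub>) ?S"
    by (rule R.add.finprod_cong') (use sup c hom component_of_mem in auto)
  also have "\<dots> = \<one>\<^bsub>R\<^esub>" using sum_component_of by simp
  finally show ?thesis using component_of_mem[of "\<one>\<^bsub>R\<^esub>" "\<one>"] by simp
qed

section \<open>Units supported in a totally ordered set of degrees\<close>

text \<open>The greatest degree \<open>s\<close> of \<open>x\<close> and the least one \<open>u\<close> each contribute a unique product to
  \<open>x \<otimes>\<^bsub>R\<^esub> y = \<one>\<^bsub>R\<^esub>\<close>, so both are inverse to degrees of \<open>y\<close>; the maximality
  of the partner of \<open>s\<close> then leaves room for a single degree.\<close>

theorem unit_homogeneous:
  assumes P: "positive_cone G P" and simple: "graded_simple G R A" and x: "x \<in> Units R"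
    and total: "\<And>s s'. s \<in> support x \<Longrightarrow> s' \<in> support x \<Longrightarrow> s \<otimes> inv s' \<in> P \<or> s' \<otimes> inv s \<in> P"
  shows "x \<in> homogeneous G A"
proof -
  obtain y where y: "y \<in> carrier R" and xy: "x \<otimes>\<^bsub>R\<^esub> y = \<one>\<^bsub>R\<^esub>" using x by (auto simp: Units_def)
  have xc: "x \<in> carrier R" using x by auto
  have nz: "\<one>\<^bsub>R\<^esub> \<noteq> \<zero>\<^bsub>R\<^esub>" using simple R.carrier_one_zero by (auto simp: graded_simple_def)
  have supp: "finite (support z)" "support z \<noteq> {}" "support z \<subseteq> carrier G"
    if "z \<in> carrier R" "z \<noteq> \<zero>\<^bsub>R\<^esub>" for z
  proof -
    show "support z \<noteq> {}"
    proof
      assume "support z = {}"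
      then show False using sum_component_of[OF that(1)] that(2) by (simp only: R.finsum_empty simp_thms)
    qed
  qed (use finite_support[OF that(1)] in \<open>auto simp: support_def\<close>)
  have "x \<noteq> \<zero>\<^bsub>R\<^esub>" "y \<noteq> \<zero>\<^bsub>R\<^esub>" using xy nz xc y by auto
  note sx = supp[OF xc this(1)] and sy = supp[OF y this(2)]
  have prod: "t = inv s"
    if s: "s \<in> support x" and t: "t \<in> support y"
    and uniq: "\<And>s' t'. s' \<in> support x \<Longrightarrow> t' \<in> support y \<Longrightarrow> s' \<otimes> t' = s \<otimes> t \<Longrightarrow> s' = s" for s t
  proof -
    have c: "s \<in> carrier G" "t \<in> carrier G" using s t by (auto simp: support_def)
    have "component_of x s \<in> homogeneous G A" "component_of x s \<noteq> \<zero>\<^bsub>R\<^esub>"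
      using s component_of_mem xc by (auto simp: homogeneous_def support_def)
    then have "component_of x s \<in> Units R" using simple by (simp add: graded_simple_def)
    then have "component_of x s \<otimes>\<^bsub>R\<^esub> component_of y t \<noteq> \<zero>\<^bsub>R\<^esub>"
      using R.Units_l_cancel[of "component_of x s" "component_of y t" "\<zero>\<^bsub>R\<^esub>"] t
        component_of_closed[OF y] R.Units_closed by (auto simp: support_def)
    then have "component_of \<one>\<^bsub>R\<^esub> (s \<otimes> t) \<noteq> \<zero>\<^bsub>R\<^esub>"
      using component_of_mult_unique_product[OF xc y s t uniq] xy by simp
    then have "s \<otimes> t = \<one>" using component_of_homogeneous[OF G.one_closed one_homogeneous, of "s \<otimes> t"] c by (auto split: if_splits)
    then show ?thesis using c by (metis G.inv_equality G.m_comm)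
  qed
  define N where "N = {x \<in> carrier G. inv x \<in> P}"
  have N: "positive_cone G N" unfolding N_def by (rule G.positive_cone_inverse[OF P])
  have swap: "inv (a \<otimes> inv b) = b \<otimes> inv a" if "a \<in> carrier G" "b \<in> carrier G" for a b
    using that by (simp add: G.inv_mult_group)
  obtain s t where st: "s \<in> support x" "t \<in> support y"
    "\<And>s'. s' \<in> support x \<Longrightarrow> s \<otimes> inv s' \<in> P" "\<And>t'. t' \<in> support y \<Longrightarrow> t' \<otimes> inv t \<in> P \<Longrightarrow> t' = t"
    "\<And>s' t'. s' \<in> support x \<Longrightarrow> t' \<in> support y \<Longrightarrow> s' \<otimes> t' = s \<otimes> t \<Longrightarrow> s' = s"
    using G.extremal_pair[OF P sx total sy] by blast
  have totalN: "s \<otimes> inv s' \<in> N \<or> s' \<otimes> inv s \<in> N" if "s \<in> support x" "s' \<in> support x" for s s'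
  proof -
    have "s \<in> carrier G" "s' \<in> carrier G" using that sx(3) by auto
    then show ?thesis using total[OF that] swap by (auto simp: N_def)
  qed
  \<comment> \<open>The inverted cone reverses the order, so the extremal \<open>u\<close> is the least degree of \<open>x\<close>.\<close>
  obtain u v where uv: "u \<in> support x" "v \<in> support y" "\<And>s'. s' \<in> support x \<Longrightarrow> u \<otimes> inv s' \<in> N"
    "\<And>t'. t' \<in> support y \<Longrightarrow> t' \<otimes> inv v \<in> N \<Longrightarrow> t' = v"
    "\<And>s' t'. s' \<in> support x \<Longrightarrow> t' \<in> support y \<Longrightarrow> s' \<otimes> t' = u \<otimes> v \<Longrightarrow> s' = u"
    using G.extremal_pair[OF N sx totalN sy] by blast
  have c: "s \<in> carrier G" "u \<in> carrier G" using st uv by (auto simp: support_def)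
  have ts: "t = inv s" using prod[OF st(1,2)] st(5) by blast
  have vu: "v = inv u" using prod[OF uv(1,2)] uv(5) by blast
  \<comment> \<open>Inversion reverses the order: \<open>u \<le> s\<close> becomes \<open>t \<le> v\<close>.\<close>
  have "v \<otimes> inv t = s \<otimes> inv u" using ts vu c by (simp add: G.m_comm)
  then have "v = t" using st(4)[OF uv(2)] st(3)[OF uv(1)] by simp
  then have us: "u = s" using ts vu c by (metis G.inv_inv)
  have "s' = s" if s': "s' \<in> support x" for s'
  proof -
    have c': "s' \<in> carrier G" using s' sx by blast
    have "s \<otimes> inv s' \<in> P" "inv (s \<otimes> inv s') \<in> P" using st(3)[OF s'] uv(3)[OF s'] us by (auto simp: N_def)
    then have "s \<otimes> inv s' = \<one>" using P by (auto simp: positive_cone_def)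
    then show ?thesis using c c' by (metis G.inv_equality G.inv_inv G.inv_closed)
  qed
  then have "support x = {s}" using st(1) by blast
  then have "x = component_of x s" using sum_component_of[OF xc] component_of_closed[OF xc c(1)] by simp
  then have "x \<in> A s" using component_of_mem[OF xc c(1)] by simp
  then show ?thesis using c by (auto simp: homogeneous_def)
qed

lemma support_coarsening:
  assumes "x \<in> coarsening G R \<psi> A h" "g \<in> support x"
  shows "\<psi> g = h"
proof -
  obtain f J where f: "finite J" "J \<subseteq> {g \<in> carrier G. \<psi> g = h}" "\<And>g. g \<in> J \<Longrightarrow> f g \<in> A g"
    "x = finsum R f J"
    using coarseningE[OF assms(1)] by blast
  have J: "J \<subseteq> carrier G" using f(2) by blast
  have "g \<in> J"
    using component_of_unique[OF f(1) J f(3), of g] assms(2) f(4) by (auto simp: support_def split: if_splits)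
  then show ?thesis using f(2) by blast
qed

lemma homogeneous_subset_coarsening:
  assumes "\<psi> \<in> hom G H"
  shows "homogeneous G A \<subseteq> homogeneous H (coarsening G R \<psi> A)"
  using component_subset_coarsening[of _ \<psi>] assms unfolding homogeneous_def hom_def by blast

end

section \<open>Simplicity and coarsening\<close>

theorem mainTheorem3:
  fixes G :: "('g, 'k) monoid_scheme" and H :: "('h, 'l) monoid_scheme"
    and R :: "('r, 'm) ring_scheme" and A :: "'g \<Rightarrow> 'r set" and \<psi> :: "'g \<Rightarrow> 'h"
  assumes "comm_group G" and "comm_group H" and "\<psi> \<in> epi G H" and "graded_ring G R A"
  shows "(graded_simple G R A \<and> homogeneous G A = homogeneous H (coarsening G R \<psi> A)
      \<longrightarrow> graded_simple H R (coarsening G R \<psi> A)) \<and>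
    (torsionfree (G\<lparr>carrier := kernel G H \<psi>\<rparr>) \<and> graded_simple H R (coarsening G R \<psi> A)
      \<longrightarrow> graded_simple G R A \<and> homogeneous G A = homogeneous H (coarsening G R \<psi> A))"
proof (intro conjI impI; elim conjE)
  assume "graded_simple G R A" "homogeneous G A = homogeneous H (coarsening G R \<psi> A)"
  then show "graded_simple H R (coarsening G R \<psi> A)" by (simp add: graded_simple_def)
next
  interpret graded_ring G R A by (rule assms(4))
  interpret H: comm_group H by (rule assms(2))
  have \<psi>: "\<psi> \<in> hom G H" using assms(3) by (simp add: epi_def)
  interpret \<psi>: group_hom G H \<psi> by unfold_locales (rule \<psi>)
  let ?K = "G\<lparr>carrier := kernel G H \<psi>\<rparr>"
  assume tf: "torsionfree ?K" and simpleH: "graded_simple H R (coarsening G R \<psi> A)"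
  show simple: "graded_simple G R A"
    using simpleH homogeneous_subset_coarsening[OF \<psi>] by (auto simp: graded_simple_def)
  have sub: "subgroup (kernel G H \<psi>) G" by (rule \<psi>.subgroup_kernel)
  interpret K: comm_group ?K
    by (rule group.group_comm_groupI[OF G.subgroup_imp_group[OF sub]])
      (use subgroup.subset[OF sub] G.m_comm in auto)
  have invK: "inv\<^bsub>?K\<^esub> k = inv\<^bsub>G\<^esub> k" if "k \<in> kernel G H \<psi>" for k
    using G.m_inv_consistent[OF sub that] .
  obtain P where PK: "positive_cone ?K P" and totalK: "\<And>k. k \<in> carrier ?K \<Longrightarrow> k \<in> P \<or> inv\<^bsub>?K\<^esub> k \<in> P"
    using K.torsionfree_total_cone[OF tf] by blast
  have PG: "P \<subseteq> kernel G H \<psi>" using PK by (simp add: positive_cone_def)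
  then have P: "positive_cone G P"
    using PK subgroup.subset[OF sub] invK unfolding positive_cone_def by (auto simp: subset_iff)
  show "homogeneous G A = homogeneous H (coarsening G R \<psi> A)"
  proof
    show "homogeneous H (coarsening G R \<psi> A) \<subseteq> homogeneous G A"
    proof
      fix x assume xH: "x \<in> homogeneous H (coarsening G R \<psi> A)"
      show "x \<in> homogeneous G A"
      proof (cases "x = \<zero>\<^bsub>R\<^esub>")
        case True
        then show ?thesis using zero_in_component[of "\<one>\<^bsub>G\<^esub>"] by (auto simp: homogeneous_def)
      next
        case False
        then have unit: "x \<in> Units R" using simpleH xH by (simp add: graded_simple_def)
        obtain h where h: "x \<in> coarsening G R \<psi> A h" using xH by (auto simp: homogeneous_def)
        show ?thesis
        proof (rule unit_homogeneous[OF P simple unit])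
          fix s s' assume s: "s \<in> support x" "s' \<in> support x"
          then have c: "s \<in> carrier G" "s' \<in> carrier G" by (auto simp: support_def)
          have "\<psi> s = \<psi> s'" using support_coarsening[OF h] s by simp
          then have k: "s \<otimes>\<^bsub>G\<^esub> inv\<^bsub>G\<^esub> s' \<in> kernel G H \<psi>" using c by (simp add: kernel_def)
          have "inv\<^bsub>G\<^esub> (s \<otimes>\<^bsub>G\<^esub> inv\<^bsub>G\<^esub> s') = s' \<otimes>\<^bsub>G\<^esub> inv\<^bsub>G\<^esub> s" using c by (simp add: G.inv_mult_group)
          then show "s \<otimes>\<^bsub>G\<^esub> inv\<^bsub>G\<^esub> s' \<in> P \<or> s' \<otimes>\<^bsub>G\<^esub> inv\<^bsub>G\<^esub> s \<in> P" using totalK[of "s \<otimes>\<^bsub>G\<^esub> inv\<^bsub>G\<^esub> s'"] k invK[OF k] by simp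
        qed
      qed
    qed
  qed (rule homogeneous_subset_coarsening[OF \<psi>])
qed

end
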